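(* Let $n\ge 2$ and let $f\colon\mathbb{R}^n\to\mathbb{R}$ be a $C^2$-differentiable function whose graph $G_f=\{(x,f(x))\,;\,x\in\mathbb{R}^n\}$ in the Lorentz-Minkowski space $\mathbb{R}^{n+1}_1$ is light-like, i.e. $B_f=0$ identically on $\mathbb{R}^n$. Then $G_f$ is a light-like hyperplane in $\mathbb{R}^{n+1}_1$.
   Context: $\mathbb{R}^{n+1}_1$ ($n\ge 2$) denotes the Lorentz-Minkowski $(n+1)$-space of signature $(+\cdots+-)$, i.e. $\mathbb{R}^{n+1}$ with the inner product $x_1y_1+\cdots+x_ny_n-x_{n+1}y_{n+1}$. For a function $f$ on a domain $\Omega\subset\mathbb{R}^n$, with $f_{x_i}=\partial f/\partial x_i$, put $$B_f:=1-f_{x_1}^2-\cdots-f_{x_n}^2.$$ A point of $\Omega$ where $B_f=0$ is called a light-like point of the graph $G_f=\{(x,f(x))\in\mathbb{R}^{n+1}_1\,;\,x\in\Omega\}$, and $G_f$ is called light-like if it consists only of light-like points. The graph is called entire if $\Omega=\mathbb{R}^n$. A light-like hyperplane is an affine hyperplane of $\mathbb{R}^{n+1}$ on which the induced metric is degenerate. *)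

theory Defs
  imports "HOL-Analysis.Analysis"
begin

text \<open>Throughout, \<open>\<Omega>\<close> is meant to be an open subset of \<open>\<real>\<^sup>n\<close>. The partial derivative is taken along
  the full coordinate line, so at a point of an open \<open>\<Omega>\<close> it only depends on \<open>f\<close> on \<open>\<Omega>\<close>.\<close>

definition partial_differentiable :: "'n \<Rightarrow> (real ^ 'n \<Rightarrow> real) \<Rightarrow> real ^ 'n \<Rightarrow> bool" where
  "partial_differentiable i f x \<longleftrightarrow> (\<lambda>t. f (x + t *\<^sub>R axis i 1)) field_differentiable (at 0)"

definition partial_deriv :: "'n \<Rightarrow> (real ^ 'n \<Rightarrow> real) \<Rightarrow> real ^ 'n \<Rightarrow> real" where
  "partial_deriv i f x = deriv (\<lambda>t. f (x + t *\<^sub>R axis i 1)) 0"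

text \<open>\<open>Ck_on k \<Omega> f\<close>: all iterated partial derivatives of \<open>f\<close> of order at most \<open>k\<close> exist and are
  continuous on \<open>\<Omega>\<close>.\<close>

primrec Ck_on :: "nat \<Rightarrow> (real ^ 'n::finite) set \<Rightarrow> (real ^ 'n \<Rightarrow> real) \<Rightarrow> bool" where
  "Ck_on 0 \<Omega> f \<longleftrightarrow> continuous_on \<Omega> f"
| "Ck_on (Suc k) \<Omega> f \<longleftrightarrow> continuous_on \<Omega> f \<and>
     (\<forall>i. (\<forall>x\<in>\<Omega>. partial_differentiable i f x) \<and> Ck_on k \<Omega> (partial_deriv i f))"

text \<open>Lorentz-Minkowski space \<open>\<real>\<^sup>n\<^sup>+\<^sup>1\<^sub>1\<close> is modelled on \<open>\<real>\<^sup>n \<times> \<real>\<close>; the last factor is the time-like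
  coordinate \<open>x\<^sub>n\<^sub>+\<^sub>1\<close>.\<close>

type_synonym 'n minkowski = "(real ^ 'n) \<times> real"

definition lorentz_inner :: "'n::finite minkowski \<Rightarrow> 'n minkowski \<Rightarrow> real" where
  "lorentz_inner p q = (\<Sum>i\<in>UNIV. fst p $ i * fst q $ i) - snd p * snd q"

definition graph_on :: "(real ^ 'n) set \<Rightarrow> (real ^ 'n \<Rightarrow> real) \<Rightarrow> 'n minkowski set" where
  "graph_on \<Omega> f = {(x, f x) | x. x \<in> \<Omega>}"

definition B :: "(real ^ 'n::finite \<Rightarrow> real) \<Rightarrow> real ^ 'n \<Rightarrow> real" where
  "B f x = 1 - (\<Sum>i\<in>UNIV. (partial_deriv i f x)\<^sup>2)"

definition light_like_point :: "(real ^ 'n::finite \<Rightarrow> real) \<Rightarrow> real ^ 'n \<Rightarrow> bool" where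
  "light_like_point f x \<longleftrightarrow> B f x = 0"

definition light_like_graph :: "(real ^ 'n::finite) set \<Rightarrow> (real ^ 'n \<Rightarrow> real) \<Rightarrow> bool" where
  "light_like_graph \<Omega> f \<longleftrightarrow> (\<forall>x\<in>\<Omega>. light_like_point f x)"

definition affine_hyperplane :: "'a::euclidean_space set \<Rightarrow> bool" where
  "affine_hyperplane H \<longleftrightarrow> affine H \<and> aff_dim H = int DIM('a) - 1"

definition direction_space :: "'a::real_vector set \<Rightarrow> 'a set" where
  "direction_space H = {p - q | p q. p \<in> H \<and> q \<in> H}"

text \<open>The induced metric on \<open>H\<close> is the restriction of the Lorentz inner product to the direction
  space of \<open>H\<close>, which is the tangent space at each point.\<close>

definition light_like_hyperplane :: "'n::finite minkowski set \<Rightarrow> bool" where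
  "light_like_hyperplane H \<longleftrightarrow> affine_hyperplane H \<and>
     (\<exists>v\<in>direction_space H. v \<noteq> 0 \<and> (\<forall>w\<in>direction_space H. lorentz_inner v w = 0))"

end

theory Submission
  imports Defs
begin

text \<open>
  The function satisfies the eikonal equation \<open>|\<nabla>f| = 1\<close> on all of \<open>\<real>\<^sup>n\<close>, and the claim is that
  its only entire solutions are affine with a unit gradient.

  By the mean value inequality \<open>f\<close> is 1-Lipschitz. The key point is that the Lipschitz bound is
  attained along the gradient line at every point: \<open>f (x + r \<nabla>f(x)) = f x + r\<close> for \<open>r > 0\<close>.
  For a slope \<open>0 \<le> a < 1\<close> the function
  \<open>z \<mapsto> f z - a |z - x|\<close> has no local maximum, because a small step in the direction \<open>\<nabla>f(z)\<close> raises
  \<open>f\<close> at rate 1 and the distance at rate at most 1; hence its maximum over a closed ball is on the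
  bounding sphere. Letting \<open>a\<close> tend to 1 gives a point at distance \<open>r\<close> from \<open>x\<close> where \<open>f\<close> has
  grown by \<open>r\<close> (\<open>unit_gradient_reaches\<close>). Then \<open>f\<close> grows at rate 1 along the whole segment to that
  point, which forces the direction of the segment to be \<open>\<nabla>f(x)\<close> (\<open>unit_gradient_ray\<close>).

  Comparing \<open>f y\<close> with \<open>f\<close> far out on the gradient ray by means of the Lipschitz bound gives
  \<open>f y \<ge> f x + \<nabla>f(x) \<bullet> (y - x)\<close>, since the Busemann function of the ray is linear. The same
  argument for \<open>- f\<close> gives the opposite inequality, so \<open>f\<close> is affine (\<open>unit_gradient_affine\<close>). Its
  graph is a hyperplane whose Lorentz normal \<open>(\<nabla>f, 1)\<close> is null and therefore tangent.
\<close>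

section \<open>Continuous partial derivatives and differentiability\<close>

definition grad :: "(real ^ 'n \<Rightarrow> real) \<Rightarrow> real ^ 'n \<Rightarrow> real ^ 'n" where
  "grad f x = (\<chi> i. partial_deriv i f x)"

lemma partial_differentiable_DERIV:
  fixes f :: "real ^ 'n \<Rightarrow> real"
  assumes "\<And>x. partial_differentiable i f x"
  shows "((\<lambda>t. f (p + t *\<^sub>R axis i 1)) has_real_derivative
           partial_deriv i f (p + s *\<^sub>R axis i 1)) (at s)"
proof -
  have "((\<lambda>t. f ((p + s *\<^sub>R axis i 1) + t *\<^sub>R axis i 1)) has_real_derivative
           partial_deriv i f (p + s *\<^sub>R axis i 1)) (at 0)"
    using assms[of "p + s *\<^sub>R axis i 1"]
    unfolding partial_differentiable_def partial_deriv_def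
    by (simp add: field_differentiable_derivI)
  then have "((\<lambda>t. f (p + (t + s) *\<^sub>R axis i 1)) has_real_derivative
           partial_deriv i f (p + s *\<^sub>R axis i 1)) (at 0)"
    by (simp add: algebra_simps)
  then show ?thesis
    using DERIV_shift[of "\<lambda>t. f (p + t *\<^sub>R axis i 1)" _ 0 s] by simp
qed

lemma partial_increment:
  fixes f :: "real ^ 'n \<Rightarrow> real"
  assumes "\<And>x. partial_differentiable i f x"
    and near: "\<And>s. \<bar>s\<bar> \<le> \<bar>c\<bar> \<Longrightarrow> \<bar>partial_deriv i f (p + s *\<^sub>R axis i 1) - D\<bar> \<le> e"
  shows "\<bar>f (p + c *\<^sub>R axis i 1) - f p - D * c\<bar> \<le> e * \<bar>c\<bar>"
proof -
  let ?\<phi> = "\<lambda>t. f (p + t *\<^sub>R axis i 1) - D * t"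
  have der: "(?\<phi> has_derivative (\<lambda>t. (partial_deriv i f (p + s *\<^sub>R axis i 1) - D) * t))
      (at s within {-\<bar>c\<bar>..\<bar>c\<bar>})" for s
    using partial_differentiable_DERIV[OF assms(1), of p s]
    unfolding has_field_derivative_def
    by (rule has_derivative_at_withinI[OF has_derivative_eq_rhs[OF has_derivative_diff[OF _ has_derivative_mult_right[OF has_derivative_ident]]]])
      (auto simp: algebra_simps)
  have "norm (?\<phi> c - ?\<phi> 0) \<le> e * norm (c - 0)"
  proof (rule differentiable_bound[OF _ der])
    show "onorm (\<lambda>t. (partial_deriv i f (p + s *\<^sub>R axis i 1) - D) * t) \<le> e"
      if "s \<in> {-\<bar>c\<bar>..\<bar>c\<bar>}" for s
      using near[of s] that
      by (intro onorm_le) (auto simp: abs_mult intro!: mult_right_mono)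
  qed auto
  then show ?thesis by simp
qed

text \<open>The telescoping argument for \<open>C\<^sup>1\<close> functions: the coordinates of the increment are switched on
  one after the other, and each switch is a one-variable mean value estimate. At most
  \<open>CARD('n)\<close> coordinates are switched on, each by at most \<open>norm h\<close>, whence the radius in which the
  partial derivatives are controlled.\<close>

lemma coordinatewise_increment:
  fixes f :: "real ^ 'n \<Rightarrow> real"
  assumes diff: "\<And>i x. partial_differentiable i f x"
    and near: "\<And>i y. norm (y - x) \<le> norm h * real CARD('n) \<Longrightarrow>
                  \<bar>partial_deriv i f y - partial_deriv i f x\<bar> \<le> e"
    and "finite S"
  shows "\<bar>f (x + (\<Sum>i\<in>S. h $ i *\<^sub>R axis i 1)) - f x - (\<Sum>i\<in>S. partial_deriv i f x * h $ i)\<bar>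
           \<le> e * norm h * real (card S)"
  using \<open>finite S\<close>
proof (induction S)
  case empty
  then show ?case by simp
next
  case (insert j S)
  define p where "p = x + (\<Sum>i\<in>S. h $ i *\<^sub>R axis i 1)"
  have e: "0 \<le> e" using near[of x j] by simp
  have card: "real (card S) + 1 \<le> real CARD('n)"
    using insert.hyps card_mono[of UNIV "insert j S"] by simp
  have "\<bar>f (p + h $ j *\<^sub>R axis j 1) - f p - partial_deriv j f x * h $ j\<bar> \<le> e * \<bar>h $ j\<bar>"
  proof (rule partial_increment[OF diff], rule near)
    fix s assume s: "\<bar>s\<bar> \<le> \<bar>h $ j\<bar>"
    have "p + s *\<^sub>R axis j 1 - x = (\<Sum>i\<in>S. h $ i *\<^sub>R axis i 1) + s *\<^sub>R axis j 1"
      by (simp add: p_def)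
    then have "norm (p + s *\<^sub>R axis j 1 - x)
        \<le> norm (\<Sum>i\<in>S. h $ i *\<^sub>R axis i (1::real)) + norm (s *\<^sub>R axis j (1::real) :: real ^ 'n)"
      by (simp only: norm_triangle_ineq)
    also have "\<dots> \<le> (\<Sum>i\<in>S. norm h) + norm h"
      using order_trans[OF s component_le_norm_cart]
      by (intro add_mono sum_norm_le) (auto simp: component_le_norm_cart norm_axis_1)
    also have "\<dots> = norm h * (real (card S) + 1)" by (simp add: algebra_simps)
    also have "\<dots> \<le> norm h * real CARD('n)" using card by (intro mult_left_mono) auto
    finally show "norm (p + s *\<^sub>R axis j 1 - x) \<le> norm h * real CARD('n)" .
  qed
  also have "\<dots> \<le> e * norm h"
    using component_le_norm_cart[of h j] e by (rule mult_left_mono)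
  finally have step: "\<bar>f (p + h $ j *\<^sub>R axis j 1) - f p - partial_deriv j f x * h $ j\<bar> \<le> e * norm h" .
  have eq: "x + (\<Sum>i\<in>insert j S. h $ i *\<^sub>R axis i 1) = p + h $ j *\<^sub>R axis j 1"
    using insert.hyps by (simp add: p_def algebra_simps)
  have "e * norm h * real (card (insert j S)) = e * norm h * real (card S) + e * norm h"
    using insert.hyps by (simp add: algebra_simps)
  with step insert.IH insert.hyps show ?case
    unfolding eq p_def[symmetric] by simp
qed

lemma continuous_partials_has_derivative:
  fixes f :: "real ^ 'n \<Rightarrow> real"
  assumes diff: "\<And>i x. partial_differentiable i f x"
    and cont: "\<And>i. continuous_on UNIV (partial_deriv i f)"
  shows "(f has_derivative (\<lambda>h. grad f x \<bullet> h)) (at x)"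
  unfolding has_derivative_at_alt
proof (intro conjI allI impI)
  show "bounded_linear (\<lambda>h. grad f x \<bullet> h)" by (rule bounded_linear_inner_right)
next
  fix e :: real assume "0 < e"
  define N where "N = real CARD('n)"
  have N: "0 < N" by (simp add: N_def)
  have "\<forall>\<^sub>F y in nhds x. \<forall>i. \<bar>partial_deriv i f y - partial_deriv i f x\<bar> < e / N"
  proof (rule eventually_all_finite)
    fix i
    have "(partial_deriv i f \<longlongrightarrow> partial_deriv i f x) (nhds x)"
      using cont[of i] by (simp add: continuous_on_eq_continuous_at isCont_def tendsto_at_iff_tendsto_nhds)
    then show "\<forall>\<^sub>F y in nhds x. \<bar>partial_deriv i f y - partial_deriv i f x\<bar> < e / N"
      using N \<open>0 < e\<close> by (auto dest!: tendstoD[where e = "e / N"] simp: dist_real_def)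
  qed
  then obtain d where "0 < d"
    and d: "\<And>i y. dist y x < d \<Longrightarrow> \<bar>partial_deriv i f y - partial_deriv i f x\<bar> < e / N"
    unfolding eventually_nhds_metric by blast
  show "\<exists>d>0. \<forall>y. norm (y - x) < d \<longrightarrow>
      norm (f y - f x - grad f x \<bullet> (y - x)) \<le> e * norm (y - x)"
  proof (intro exI[of _ "d / N"] conjI allI impI)
    show "0 < d / N" using \<open>0 < d\<close> N by simp
    fix y assume y: "norm (y - x) < d / N"
    have close: "\<bar>partial_deriv i f z - partial_deriv i f x\<bar> \<le> e / N"
      if "norm (z - x) \<le> norm (y - x) * real CARD('n)" for i z
      using that y d[of z i] N by (simp add: N_def dist_norm field_simps)
    have h: "x + (\<Sum>i\<in>UNIV. (y - x) $ i *\<^sub>R axis i 1) = y"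
      using basis_expansion[of "y - x"] by (simp add: scalar_mult_eq_scaleR)
    show "norm (f y - f x - grad f x \<bullet> (y - x)) \<le> e * norm (y - x)"
      using coordinatewise_increment[where S = UNIV and h = "y - x", OF diff close finite] N
      unfolding h by (simp add: grad_def inner_vec_def N_def)
  qed
qed

section \<open>Entire functions with a unit gradient\<close>

lemma unit_gradient_lipschitz:
  fixes f :: "'a::euclidean_space \<Rightarrow> real"
  assumes deriv: "\<And>x. (f has_derivative (\<lambda>h. G x \<bullet> h)) (at x)"
    and unit: "\<And>x. norm (G x) = 1"
  shows "f y - f x \<le> norm (y - x)"
proof -
  have "norm (f y - f x) \<le> 1 * norm (y - x)"
  proof (rule differentiable_bound[OF convex_UNIV])
    show "(f has_derivative (\<lambda>h. G x \<bullet> h)) (at x within UNIV)" for x by (rule deriv)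
    show "onorm (\<lambda>h. G x \<bullet> h) \<le> 1" for x
      using Cauchy_Schwarz_ineq2[of "G x"] by (intro onorm_le) (simp add: unit)
  qed auto
  then show ?thesis by simp
qed

lemma unit_gradient_reaches:
  fixes f :: "'a::euclidean_space \<Rightarrow> real"
  assumes deriv: "\<And>x. (f has_derivative (\<lambda>h. G x \<bullet> h)) (at x)"
    and unit: "\<And>x. norm (G x) = 1"
    and "0 < r"
  obtains w where "norm (w - x) \<le> r" "f x + r \<le> f w"
proof -
  have cont: "continuous_on (cball x r) f"
    using deriv has_derivative_continuous continuous_at_imp_continuous_on by blast
  have ball: "compact (cball x r)" "cball x r \<noteq> {}" using \<open>0 < r\<close> by auto
  obtain w where w: "w \<in> cball x r" and max: "\<And>z. z \<in> cball x r \<Longrightarrow> f z \<le> f w"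
    using continuous_attains_sup[OF ball cont] by blast
  have "f x + r \<le> f w"
  proof (rule ccontr)
    assume "\<not> f x + r \<le> f w"
    \<comment> \<open>A slope below 1 that is still larger than the best average growth on the ball; it is
      taken nonnegative so that an upper bound for the distance gives one for the penalty.\<close>
    then have "max 0 ((f w - f x) / r) < 1" using \<open>0 < r\<close> by (simp add: field_simps)
    then obtain a where a: "max 0 ((f w - f x) / r) < a" "a < 1" using dense by blast
    let ?g = "\<lambda>z. f z - a * norm (z - x)"
    obtain z where z: "z \<in> cball x r" and zmax: "\<And>y. y \<in> cball x r \<Longrightarrow> ?g y \<le> ?g z"
    proof -
      have "continuous_on (cball x r) ?g" using cont by (intro continuous_intros)
      from continuous_attains_sup[OF ball this] show ?thesis using that by blast
    qed
    have "norm (z - x) = r"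
    proof (rule ccontr)
      assume "norm (z - x) \<noteq> r"
      with z have in_ball: "norm (z - x) < r" by (simp add: dist_norm norm_minus_commute)
      \<comment> \<open>A step \<open>h\<close> along the gradient gains at least \<open>(1 - e) h\<close> and costs at most \<open>a h\<close>; this
        choice of \<open>e\<close> leaves a net gain of \<open>e h\<close>.\<close>
      define e where "e = (1 - a) / 2"
      have "0 < e" using a by (simp add: e_def)
      then obtain d where "0 < d"
        and d: "\<And>y. norm (y - z) < d \<Longrightarrow> norm (f y - f z - G z \<bullet> (y - z)) \<le> e * norm (y - z)"
        using deriv[of z] unfolding has_derivative_at_alt by blast
      define h where "h = min (d / 2) (r - norm (z - x))"
      have h: "0 < h" "h < d" "norm (z - x) + h \<le> r"
        using \<open>0 < d\<close> in_ball by (auto simp: h_def)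
      define y where "y = z + h *\<^sub>R G z"
      have "G z \<bullet> G z = 1" using unit[of z] by (simp add: norm_eq_1)
      then have "\<bar>f y - f z - h\<bar> \<le> e * h"
        using d[of y] h by (simp add: y_def unit)
      then have grow: "f z + h - e * h \<le> f y" by linarith
      have far: "norm (y - x) \<le> norm (z - x) + h"
        using norm_triangle_ineq[of "z - x" "h *\<^sub>R G z"] h
        by (simp add: y_def unit algebra_simps)
      then have "a * norm (y - x) \<le> a * norm (z - x) + a * h"
        using mult_left_mono[OF far, of a] a by (simp add: algebra_simps)
      moreover have "h - e * h - a * h = e * h" by (simp add: e_def field_simps)
      moreover have "0 < e * h" using \<open>0 < e\<close> h by simp
      ultimately have "?g z < ?g y" using grow by linarith
      moreover have "y \<in> cball x r" using far h by (simp add: dist_norm norm_minus_commute)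
      ultimately show False using zmax[of y] by linarith
    qed
    then have "f x + a * r \<le> f z" using zmax[of x] \<open>0 < r\<close> by simp
    moreover have "f w - f x < a * r" using a \<open>0 < r\<close> by (simp add: field_simps)
    ultimately show False using max[OF z] by linarith
  qed
  with w show thesis by (intro that[of w]) (auto simp: dist_norm norm_minus_commute)
qed

lemma unit_gradient_ray:
  fixes f :: "'a::euclidean_space \<Rightarrow> real"
  assumes deriv: "\<And>x. (f has_derivative (\<lambda>h. G x \<bullet> h)) (at x)"
    and unit: "\<And>x. norm (G x) = 1"
    and "0 < r"
  shows "f x + r \<le> f (x + r *\<^sub>R G x)"
proof -
  note lip = unit_gradient_lipschitz[OF deriv unit]
  obtain w where w: "norm (w - x) \<le> r" "f x + r \<le> f w"
    using unit_gradient_reaches[OF deriv unit \<open>0 < r\<close>] by blast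
  then have nw: "norm (w - x) = r" using lip[of w x] by linarith
  define u where "u = (1 / r) *\<^sub>R (w - x)"
  have w_eq: "w = x + r *\<^sub>R u" using \<open>0 < r\<close> by (simp add: u_def)
  have u: "norm u = 1" using nw \<open>0 < r\<close> by (simp add: u_def)
  have linear: "f x + t \<le> f (x + t *\<^sub>R u)" if "0 \<le> t" "t \<le> r" for t
  proof -
    have "w - (x + t *\<^sub>R u) = (r - t) *\<^sub>R u" by (simp add: w_eq algebra_simps)
    then have "norm (w - (x + t *\<^sub>R u)) = r - t" using that u by simp
    then show ?thesis using lip[of w "x + t *\<^sub>R u"] w by linarith
  qed
  have "1 \<le> G x \<bullet> u"
  proof (rule field_le_epsilon)
    fix e :: real assume "0 < e"
    then obtain d where "0 < d"
      and d: "\<And>y. norm (y - x) < d \<Longrightarrow> norm (f y - f x - G x \<bullet> (y - x)) \<le> e * norm (y - x)"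
      using deriv[of x] unfolding has_derivative_at_alt by blast
    define t where "t = min (d / 2) r"
    have t: "0 < t" "t < d" "t \<le> r" using \<open>0 < d\<close> \<open>0 < r\<close> by (auto simp: t_def)
    have "\<bar>f (x + t *\<^sub>R u) - f x - t * (G x \<bullet> u)\<bar> \<le> e * t"
      using d[of "x + t *\<^sub>R u"] t u by simp
    with linear[of t] t have "t * 1 \<le> t * (G x \<bullet> u + e)" by (simp add: algebra_simps)
    then show "1 \<le> G x \<bullet> u + e" using t by (simp only: mult_le_cancel_left_pos)
  qed
  then have "(norm (G x - u))\<^sup>2 \<le> 0"
    using unit[of x] u by (simp add: power2_norm_eq_inner inner_diff inner_commute norm_eq_1)
  then have "u = G x" by simp
  with w w_eq show ?thesis by simp
qed

text \<open>The Busemann function of the ray \<open>r \<mapsto> r *\<^sub>R v\<close>, the limit of \<open>r - norm (d - r *\<^sub>R v)\<close>, is the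
  linear form \<open>d \<bullet> v\<close>; this is the inequality that the comparison with a distant point needs.\<close>

lemma busemann_bound:
  fixes d v :: "'a::real_inner"
  assumes "norm v = 1" and ray: "\<And>r. 0 < r \<Longrightarrow> r \<le> c + norm (d - r *\<^sub>R v)"
  shows "d \<bullet> v \<le> c"
proof (rule ccontr)
  assume "\<not> d \<bullet> v \<le> c"
  then have gap: "0 < d \<bullet> v - c" by simp
  define r where "r = \<bar>c\<bar> + 1 + (norm d)\<^sup>2 / (d \<bullet> v - c)"
  have r: "0 < r" "c < r" "(norm d)\<^sup>2 / (d \<bullet> v - c) < r"
    using divide_nonneg_pos[OF zero_le_power2 gap, of "norm d"] unfolding r_def by linarith+
  have "(r - c)\<^sup>2 \<le> (norm (d - r *\<^sub>R v))\<^sup>2"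
    using ray[of r] r by (intro power_mono) auto
  also have "\<dots> = (norm d)\<^sup>2 - 2 * r * (d \<bullet> v) + r\<^sup>2"
    using \<open>norm v = 1\<close> unfolding power2_norm_eq_inner norm_eq_1
    by (simp add: inner_diff inner_commute power2_eq_square)
  finally have "2 * (r * (d \<bullet> v - c)) + c\<^sup>2 \<le> (norm d)\<^sup>2"
    by (simp add: power2_eq_square algebra_simps)
  moreover have "(norm d)\<^sup>2 < r * (d \<bullet> v - c)" using r gap by (simp add: field_simps)
  moreover have "0 \<le> c\<^sup>2" "0 \<le> (norm d)\<^sup>2" by simp_all
  ultimately show False by linarith
qed

lemma unit_gradient_above_tangent:
  fixes f :: "'a::euclidean_space \<Rightarrow> real"
  assumes deriv: "\<And>x. (f has_derivative (\<lambda>h. G x \<bullet> h)) (at x)"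
    and unit: "\<And>x. norm (G x) = 1"
  shows "f x + G x \<bullet> (y - x) \<le> f y"
proof -
  have "(y - x) \<bullet> G x \<le> f y - f x"
  proof (rule busemann_bound[OF unit])
    fix r :: real assume "0 < r"
    have "norm (x + r *\<^sub>R G x - y) = norm (y - x - r *\<^sub>R G x)"
      by (subst norm_minus_commute) (simp add: algebra_simps)
    then show "r \<le> f y - f x + norm (y - x - r *\<^sub>R G x)"
      using unit_gradient_ray[OF deriv unit \<open>0 < r\<close>, of x]
        unit_gradient_lipschitz[OF deriv unit, of "x + r *\<^sub>R G x" y] by linarith
  qed
  then show ?thesis by (simp add: inner_commute)
qed

lemma unit_gradient_affine:
  fixes f :: "'a::euclidean_space \<Rightarrow> real"
  assumes deriv: "\<And>x. (f has_derivative (\<lambda>h. G x \<bullet> h)) (at x)"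
    and unit: "\<And>x. norm (G x) = 1"
  shows "f y = f x + G x \<bullet> (y - x)"
proof -
  have "((\<lambda>x. - f x) has_derivative (\<lambda>h. (- G x) \<bullet> h)) (at x)" for x
    using has_derivative_minus[OF deriv[of x]] by simp
  from unit_gradient_above_tangent[of "\<lambda>x. - f x" "\<lambda>x. - G x" x y, OF this]
  have "- f x + (- G x) \<bullet> (y - x) \<le> - f y" using unit by simp
  with unit_gradient_above_tangent[OF deriv unit, of x y] show ?thesis by simp
qed

section \<open>Light-like graphs\<close>

lemma light_like_point_iff_norm_grad: "light_like_point f x \<longleftrightarrow> norm (grad f x) = 1"
  by (auto simp: light_like_point_def B_def norm_eq_1 inner_vec_def grad_def power2_eq_square)

text \<open>The vector \<open>(v, 1)\<close> is Lorentz orthogonal to the tangent space of the graph, which is the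
  Euclidean orthogonal complement of \<open>(v, - 1)\<close>; since \<open>v\<close> is a unit vector, \<open>(v, 1)\<close> lies in that
  tangent space and makes the induced metric degenerate.\<close>

lemma affine_graph_light_like_hyperplane:
  fixes v :: "real ^ 'n" and c :: real
  assumes unit: "norm v = 1"
  shows "light_like_hyperplane (graph_on UNIV (\<lambda>x. c + v \<bullet> x))"
proof -
  let ?H = "graph_on UNIV (\<lambda>x. c + v \<bullet> x)"
  have H: "?H = {p. (v, - 1) \<bullet> p = - c}"
    by (auto simp: graph_on_def inner_prod_def)
  have "affine_hyperplane ?H"
    unfolding affine_hyperplane_def H using aff_dim_hyperplane[of "(v, - 1 :: real)" "- c"]
    by (auto simp: affine_hyperplane zero_prod_def)
  moreover have "(v, 1) \<in> direction_space ?H"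
  proof -
    have "(v, c + v \<bullet> v) \<in> ?H" "(0, c) \<in> ?H" by (auto simp: graph_on_def)
    moreover have "(v, 1) = (v, c + v \<bullet> v) - (0, c)" using unit by (simp add: norm_eq_1)
    ultimately show ?thesis unfolding direction_space_def by blast
  qed
  moreover have "lorentz_inner (v, 1) w = 0" if "w \<in> direction_space ?H" for w
  proof -
    from that obtain a b where "w = (a, c + v \<bullet> a) - (b, c + v \<bullet> b)"
      unfolding direction_space_def graph_on_def by blast
    then have "snd w = v \<bullet> fst w" by (simp add: inner_diff_right)
    then show ?thesis by (simp add: lorentz_inner_def inner_vec_def)
  qed
  moreover have "(v, 1 :: real) \<noteq> 0" by (simp add: zero_prod_def)
  ultimately show ?thesis unfolding light_like_hyperplane_def by blast
qed

theorem corollaryB: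
  fixes f :: "real ^ 'n \<Rightarrow> real"
  assumes "CARD('n) \<ge> 2"
    and "Ck_on 2 UNIV f"
    and "light_like_graph UNIV f"
  shows "light_like_hyperplane (graph_on UNIV f)"
proof -
  have diff: "partial_differentiable i f x" and cont: "continuous_on UNIV (partial_deriv i f)"
    for i x
    using assms(2) by (auto simp: numeral_2_eq_2)
  note deriv = continuous_partials_has_derivative[OF diff cont]
  have unit: "norm (grad f x) = 1" for x
    using assms(3) by (simp add: light_like_graph_def light_like_point_iff_norm_grad)
  have "f y = f 0 + grad f 0 \<bullet> y" for y
    using unit_gradient_affine[OF deriv unit, of y 0] by simp
  then have "graph_on UNIV f = graph_on UNIV (\<lambda>y. f 0 + grad f 0 \<bullet> y)"
    by (intro arg_cong[of f _ "graph_on UNIV"] ext)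
  then show ?thesis
    by (simp only: affine_graph_light_like_hyperplane[OF unit])
qed

end
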